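(* Let $s$ be a weak composition. The cover relations of the $s$-Tamari lattice are in correspondence with $s$-Tamari rotations; that is, for $s$-Tamari trees $T,T'$, the tree $T'$ covers $T$ in the $s$-Tamari lattice if and only if there is a Tamari-ascent $(a,c)$ of $T$ such that $$\operatorname{inv}(T')=\bigl(\operatorname{inv}(T)+(c,a)\bigr)^{\mathsf{tc}}.$$
   Context: A weak composition is a finite sequence $s=(s(1),\dots,s(n))$ of nonnegative integers. An $s$-decreasing tree is a rooted planar tree with exactly $n$ internal nodes, labelled bijectively by $1,\dots,n$ (an internal node is identified with its label; the other nodes are unlabelled leaves), such that internal node $i$ has exactly $s(i)+1$ ordered children and all internal nodes that are descendants of $i$ have labels smaller than $i$. For a node $y$ of $T$, $T^y_0,\dots,T^y_{s(y)}$ denote its child subtrees from left to right, and $x\in T^y_i$ means that internal node $x$ lies in that subtree. If $x<y$ and $x$ is not a descendant of $y$, let $z$ be the first (closest) common ancestor of $x$ and $y$, with $x\in T^z_j$, $y\in T^z_i$, $i\neq j$; $x$ is left of $y$ if $j<i$ and right of $y$ if $j>i$. For $x<y$ the cardinality $\#_T(y,x)$ is: $0$ if $x$ is left of $y$; $i$ if $x\in T^y_i$; $s(y)$ if $x$ is right of $y$. $\operatorname{inv}(T)$ is the multiset of pairs $(y,x)$, $1\le x<y\le n$, with multiplicities $\#_T(y,x)$; $T$ is determined by $\operatorname{inv}(T)$. The $s$-weak order is defined by $R\preccurlyeq T$ iff $\#_R(y,x)\le \#_T(y,x)$ for all $x<y$. An $s$-decreasing tree $T$ is an $s$-Tamari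 tree if $\#_T(c,a)\le\#_T(c,b)$ for all $a<b<c$. The $s$-Tamari lattice is the restriction of the $s$-weak order to the set of $s$-Tamari trees. For a multiset $I$ of pairs $(y,x)$, $1\le x<y\le n$, with multiplicities $\#_I(y,x)$, $I+(c,a)$ is obtained by increasing the multiplicity of $(c,a)$ by one, and the transitive closure $I^{\mathsf{tc}}$ is the multiset in which the multiplicity of $(c,a)$ is the maximum of $\#_I(b_1,b_2)$ over all lists $c=b_1>\dots>b_k=a$, $k\ge2$, with $\#_I(b_i,b_{i+1})>0$ for $1\le i<k$ ($0$ if there is none). A pair $(a,c)$ with $a<c$ is a Tamari-ascent of an $s$-Tamari tree $T$ if $a$ is a non-right child of $c$, i.e. $a$ is the root of $T^c_i$ for some $0\le i<s(c)$ (a direct child, not just a descendant). For a Tamari-ascent $(a,c)$ of $T$, the $s$-Tamari tree whose multiset of tree-inversions is $(\operatorname{inv}(T)+(c,a))^{\mathsf{tc}}$ is called an $s$-Tamari rotation of $T$. *)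

theory Defs
  imports "HOL-Library.Multiset"
begin

section \<open>Weak compositions and s-decreasing trees\<close>

text \<open>
  A weak composition is a list of natural numbers, read with 1-based indices:
  \<open>part s i\<close> is \<open>s(i)\<close> for \<open>1 \<le> i \<le> length s\<close>.
\<close>

definition part :: "nat list \<Rightarrow> nat \<Rightarrow> nat" where
  "part s i = s ! (i - 1)"

datatype tree = Leaf | Node nat "tree list"

fun labels :: "tree \<Rightarrow> nat list" where
  "labels Leaf = []"
| "labels (Node y ts) = y # concat (map labels ts)"

fun subtrees :: "tree \<Rightarrow> tree set" where
  "subtrees Leaf = {Leaf}"
| "subtrees (Node y ts) = insert (Node y ts) (\<Union>t\<in>set ts. subtrees t)"

definition s_decreasing_tree :: "nat list \<Rightarrow> tree \<Rightarrow> bool" where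
  "s_decreasing_tree s T \<longleftrightarrow>
     distinct (labels T) \<and> set (labels T) = {1..length s} \<and>
     (\<forall>y ts. Node y ts \<in> subtrees T \<longrightarrow>
        length ts = part s y + 1 \<and>
        (\<forall>t\<in>set ts. \<forall>x\<in>set (labels t). x < y))"

text \<open>\<open>in_child T y i x\<close> stands for \<open>x \<in> T\<^sup>y\<^sub>i\<close>.\<close>

definition in_child :: "tree \<Rightarrow> nat \<Rightarrow> nat \<Rightarrow> nat \<Rightarrow> bool" where
  "in_child T y i x \<longleftrightarrow>
     (\<exists>ts. Node y ts \<in> subtrees T \<and> i < length ts \<and> x \<in> set (labels (ts ! i)))"

text \<open>\<open>descendant T y x\<close>: the node \<open>x\<close> is a (proper) descendant of the node \<open>y\<close>.\<close>

definition descendant :: "tree \<Rightarrow> nat \<Rightarrow> nat \<Rightarrow> bool" where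
  "descendant T y x \<longleftrightarrow> (\<exists>i. in_child T y i x)"

definition closest_common_ancestor :: "tree \<Rightarrow> nat \<Rightarrow> nat \<Rightarrow> nat \<Rightarrow> bool" where
  "closest_common_ancestor T x y z \<longleftrightarrow>
     descendant T z x \<and> descendant T z y \<and>
     \<not> (\<exists>w. descendant T z w \<and> descendant T w x \<and> descendant T w y)"

definition left_of :: "tree \<Rightarrow> nat \<Rightarrow> nat \<Rightarrow> bool" where
  "left_of T x y \<longleftrightarrow>
     (\<exists>z i j. closest_common_ancestor T x y z \<and> in_child T z j x \<and> in_child T z i y \<and> j < i)"


section \<open>Tree-inversions and the s-weak order\<close>

text \<open>
  \<open>inv_card s T y x\<close> is \<open>#\<^sub>T(y,x)\<close>, meaningful for nodes \<open>x < y\<close> of an s-decreasing tree \<open>T\<close>.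
  There \<open>y\<close> is not a descendant of \<open>x\<close>, so the last case below is exactly
  the case that \<open>x\<close> is right of \<open>y\<close>.
\<close>

definition inv_card :: "nat list \<Rightarrow> tree \<Rightarrow> nat \<Rightarrow> nat \<Rightarrow> nat" where
  "inv_card s T y x =
     (if descendant T y x then (THE i. in_child T y i x)
      else if left_of T x y then 0
      else part s y)"

definition tree_inv :: "nat list \<Rightarrow> tree \<Rightarrow> (nat \<times> nat) multiset" where
  "tree_inv s T =
     Abs_multiset (\<lambda>(y, x). if 1 \<le> x \<and> x < y \<and> y \<le> length s then inv_card s T y x else 0)"

lemma count_tree_inv:
  "count (tree_inv s T) (y, x) =
     (if 1 \<le> x \<and> x < y \<and> y \<le> length s then inv_card s T y x else 0)"
proof -
  let ?f = "\<lambda>(y, x). if 1 \<le> x \<and> x < y \<and> y \<le> length s then inv_card s T y x else 0"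
  have "{p. 0 < ?f p} \<subseteq> {..length s} \<times> {..length s}"
    by (auto split: if_splits)
  then have "finite {p. 0 < ?f p}"
    by (rule finite_subset) simp
  then show ?thesis
    unfolding tree_inv_def by (simp add: Abs_multiset_inverse)
qed

definition s_weak_le :: "nat list \<Rightarrow> tree \<Rightarrow> tree \<Rightarrow> bool" where
  "s_weak_le s R T \<longleftrightarrow>
     (\<forall>x y. 1 \<le> x \<and> x < y \<and> y \<le> length s \<longrightarrow> inv_card s R y x \<le> inv_card s T y x)"


section \<open>The s-Tamari lattice\<close>

definition s_tamari_tree :: "nat list \<Rightarrow> tree \<Rightarrow> bool" where
  "s_tamari_tree s T \<longleftrightarrow>
     s_decreasing_tree s T \<and>
     (\<forall>a b c. 1 \<le> a \<and> a < b \<and> b < c \<and> c \<le> length s \<longrightarrow> inv_card s T c a \<le> inv_card s T c b)"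

text \<open>\<open>y\<close> covers \<open>x\<close> in the set \<open>A\<close> ordered by \<open>le\<close>.\<close>

definition covers_in :: "'a set \<Rightarrow> ('a \<Rightarrow> 'a \<Rightarrow> bool) \<Rightarrow> 'a \<Rightarrow> 'a \<Rightarrow> bool" where
  "covers_in A le y x \<longleftrightarrow>
     x \<in> A \<and> y \<in> A \<and> le x y \<and> x \<noteq> y \<and>
     \<not> (\<exists>z\<in>A. le x z \<and> z \<noteq> x \<and> le z y \<and> z \<noteq> y)"

definition s_tamari_covers :: "nat list \<Rightarrow> tree \<Rightarrow> tree \<Rightarrow> bool" where
  "s_tamari_covers s T' T \<longleftrightarrow> covers_in {R. s_tamari_tree s R} (s_weak_le s) T' T"

definition tamari_ascent :: "nat list \<Rightarrow> tree \<Rightarrow> nat \<Rightarrow> nat \<Rightarrow> bool" where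
  "tamari_ascent s T a c \<longleftrightarrow>
     a < c \<and>
     (\<exists>ts i us. Node c ts \<in> subtrees T \<and> i < part s c \<and> ts ! i = Node a us)"


section \<open>Transitive closure of a multiset of pairs\<close>

definition tc_path :: "(nat \<times> nat) multiset \<Rightarrow> nat \<Rightarrow> nat \<Rightarrow> nat list \<Rightarrow> bool" where
  "tc_path I c a bs \<longleftrightarrow>
     2 \<le> length bs \<and> hd bs = c \<and> last bs = a \<and> sorted_wrt (>) bs \<and>
     (\<forall>i. i + 1 < length bs \<longrightarrow> count I (bs ! i, bs ! (i + 1)) > 0)"

definition tc :: "(nat \<times> nat) multiset \<Rightarrow> (nat \<times> nat) multiset" where
  "tc I = Abs_multiset (\<lambda>(c, a).
     Max (insert 0 {count I (bs ! 0, bs ! 1) | bs. tc_path I c a bs}))"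

lemma tc_path_endpoints:
  assumes "tc_path I c a bs"
  shows "c \<in> fst ` set_mset I" and "a \<in> snd ` set_mset I"
proof -
  have len: "2 \<le> length bs" and ne: "bs \<noteq> []"
    using assms by (auto simp: tc_path_def)
  have pos: "(bs ! i, bs ! (i + 1)) \<in># I" if "i + 1 < length bs" for i
    using assms that unfolding tc_path_def count_greater_zero_iff by blast
  show "c \<in> fst ` set_mset I"
    using pos[of 0] len ne assms by (force simp: tc_path_def hd_conv_nth)
  show "a \<in> snd ` set_mset I"
    using pos[of "length bs - 2"] len ne assms
    by (force simp: tc_path_def last_conv_nth Suc_diff_Suc numeral_2_eq_2)
qed

lemma finite_tc_values:
  "finite {count I (bs ! 0, bs ! 1) | bs. tc_path I c a bs}"
proof (rule finite_subset)
  show "{count I (bs ! 0, bs ! 1) | bs. tc_path I c a bs} \<subseteq> count I ` set_mset I"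
    by (force simp: tc_path_def)
qed simp

lemma count_tc:
  "count (tc I) (c, a) = Max (insert 0 {count I (bs ! 0, bs ! 1) | bs. tc_path I c a bs})"
proof -
  let ?f = "\<lambda>(c, a). Max (insert 0 {count I (bs ! 0, bs ! 1) | bs. tc_path I c a bs})"
  have "{p. 0 < ?f p} \<subseteq> (fst ` set_mset I) \<times> (snd ` set_mset I)"
  proof clarify
    fix c a
    assume "0 < Max (insert 0 {count I (bs ! 0, bs ! 1) | bs. tc_path I c a bs})"
    then have "\<exists>v\<in>insert 0 {count I (bs ! 0, bs ! 1) | bs. tc_path I c a bs}. 0 < v"
      by (subst (asm) Max_gr_iff) (use finite_tc_values in blast)+
    then obtain bs where "tc_path I c a bs"
      by blast
    then show "c \<in> fst ` set_mset I \<and> a \<in> snd ` set_mset I"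
      using tc_path_endpoints by blast
  qed
  then have "finite {p. 0 < ?f p}"
    by (rule finite_subset) simp
  then show ?thesis
    unfolding tc_def by (simp add: Abs_multiset_inverse)
qed

end

theory Submission
  imports Defs
begin

text \<open>
  In an s-Tamari tree the smaller of two incomparable nodes always lies to the left, so
  \<open>#\<^sub>T(y,x)\<close> is the index of the child of \<open>y\<close> containing \<open>x\<close>, or \<open>0\<close> if \<open>x\<close> is not a
  descendant of \<open>y\<close>. Thus s-Tamari trees correspond to bounded functions \<open>f\<close> that are monotone
  in the second argument and satisfy \<open>f z y \<le> f z x\<close> whenever \<open>f y x > 0\<close>. For a Tamari-ascent
  \<open>(a,c)\<close>, the transitive closure of \<open>f + (c,a)\<close> differs from \<open>f\<close> only by an increment at the
  pairs \<open>(c,x)\<close> with \<open>x = a\<close> or \<open>f a x > 0\<close>. A function between \<open>f\<close> and this closure that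
  increments \<open>(c,a)\<close> must by transitivity increment all these pairs, and one that does not can by
  monotonicity increment none, so rotations are covers. Conversely, if \<open>f < h\<close>, the
  lexicographically largest \<open>(c,a)\<close> with \<open>f c a < h c a\<close> is a Tamari-ascent of \<open>f\<close> whose rotation
  lies below \<open>h\<close>.
\<close>

section \<open>Decreasing trees and their descendant relation\<close>

lemma disjoint_children:
  assumes "distinct (concat (map labels ts))" "i < length ts" "j < length ts"
    and "x \<in> set (labels (ts ! i))" "x \<in> set (labels (ts ! j))"
  shows "i = j"
  using assms
proof (induction ts arbitrary: i j)
  case (Cons t ts)
  have *: "x \<in> set (concat (map labels ts))" if "k < length ts" "x \<in> set (labels (ts ! k))" for k
    using that by (auto intro!: bexI[of _ "ts ! k"])
  show ?case
  proof (cases i; cases j)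
    fix k l assume "i = Suc k" "j = Suc l"
    then show ?thesis using Cons.prems Cons.IH[of k l] by auto
  qed (use Cons.prems * in \<open>auto simp: disjoint_iff\<close>)
qed simp

lemma labels_subtree: "t \<in> subtrees T \<Longrightarrow> set (labels t) \<subseteq> set (labels T)"
  by (induction T) auto

lemma subtrees_trans: "t \<in> subtrees T \<Longrightarrow> subtrees t \<subseteq> subtrees T"
  by (induction T) auto

lemma subtrees_refl: "T \<in> subtrees T"
  by (cases T) auto

lemma child_in_subtrees:
  assumes "Node y ts \<in> subtrees T" "i < length ts"
  shows "ts ! i \<in> subtrees T"
proof -
  have "ts ! i \<in> subtrees (Node y ts)"
    using assms(2) subtrees_refl[of "ts ! i"] by (auto intro!: bexI[of _ "ts ! i"])
  then show ?thesis using subtrees_trans[OF assms(1)] by blast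
qed

lemma label_in_subtrees: "x \<in> set (labels T) \<Longrightarrow> \<exists>us. Node x us \<in> subtrees T"
  by (induction T) fastforce+

lemma distinct_subtree: "t \<in> subtrees T \<Longrightarrow> distinct (labels T) \<Longrightarrow> distinct (labels t)"
proof (induction T)
  case (Node r ts)
  have "distinct (labels u)" if "u \<in> set ts" for u
    using that Node.prems(2) by (auto simp: distinct_concat_iff)
  then show ?case using Node by auto
qed simp

lemma node_label: "Node y us \<in> subtrees T \<Longrightarrow> y \<in> set (labels T)"
  using labels_subtree by fastforce

lemma distinct_children: "distinct (labels (Node r ts)) \<Longrightarrow> t \<in> set ts \<Longrightarrow> distinct (labels t)"
  by (rule distinct_subtree[of _ "Node r ts"]) (auto intro: subtrees_refl)

lemma node_unique:
  "\<lbrakk>distinct (labels T); Node y us \<in> subtrees T; Node y vs \<in> subtrees T\<rbrakk> \<Longrightarrow> us = vs"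
proof (induction T)
  case (Node r ts)
  note d = Node.prems(1)
  show ?case
  proof (cases "y = r")
    case True
    have "Node y ws \<notin> subtrees t" if "t \<in> set ts" for ws t
      using that d True node_label[of y ws t] by auto
    then show ?thesis using Node.prems(2,3) True by auto
  next
    case False
    then obtain t t' where t: "t \<in> set ts" "Node y us \<in> subtrees t"
      and t': "t' \<in> set ts" "Node y vs \<in> subtrees t'"
      using Node.prems(2,3) by auto
    obtain i j where ij: "i < length ts" "t = ts ! i" "j < length ts" "t' = ts ! j"
      using t(1) t'(1) by (auto simp: in_set_conv_nth)
    have "i = j"
      using d disjoint_children[of ts i j y] ij node_label[OF t(2)] node_label[OF t'(2)] by simp
    then have "t = t'" using ij by simp
    then show ?thesis using Node.IH[OF t(1) distinct_children[OF d t(1)]] t t' by blast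
  qed
qed simp

text \<open>This is \<open>s_decreasing_tree\<close> without the condition on the label set. In this
  form it passes to subtrees, so structural induction applies.\<close>

definition decreasing :: "nat list \<Rightarrow> tree \<Rightarrow> bool" where
  "decreasing s T \<longleftrightarrow> distinct (labels T) \<and>
     (\<forall>y ts. Node y ts \<in> subtrees T \<longrightarrow>
        length ts = part s y + 1 \<and> (\<forall>t\<in>set ts. \<forall>x\<in>set (labels t). x < y))"

lemma s_decreasing_tree_iff:
  "s_decreasing_tree s T \<longleftrightarrow> decreasing s T \<and> set (labels T) = {1..length s}"
  unfolding s_decreasing_tree_def decreasing_def by blast

lemma decreasing_subtree: "t \<in> subtrees T \<Longrightarrow> decreasing s T \<Longrightarrow> decreasing s t"
  unfolding decreasing_def using distinct_subtree subtrees_trans by blast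

lemma decreasing_child: "decreasing s (Node r ts) \<Longrightarrow> t \<in> set ts \<Longrightarrow> decreasing s t"
  by (rule decreasing_subtree[of _ "Node r ts"]) (auto intro: subtrees_refl)

lemma decreasing_Node_iff:
  "decreasing s (Node r ts) \<longleftrightarrow>
     distinct (labels (Node r ts)) \<and> length ts = part s r + 1 \<and>
     (\<forall>t\<in>set ts. decreasing s t \<and> (\<forall>x\<in>set (labels t). x < r))" (is "_ \<longleftrightarrow> ?R")
proof
  assume dec: "decreasing s (Node r ts)"
  have "Node r ts \<in> subtrees (Node r ts)" by simp
  then show ?R using dec decreasing_child[OF dec] unfolding decreasing_def[of s "Node r ts"] by blast
next
  assume ?R
  then show "decreasing s (Node r ts)" unfolding decreasing_def by auto
qed

section \<open>Child positions and ancestors\<close>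

lemma in_child_Leaf [simp]: "\<not> in_child Leaf y i x"
  by (simp add: in_child_def)

lemma in_child_Node:
  "in_child (Node r ts) y i x \<longleftrightarrow>
     y = r \<and> i < length ts \<and> x \<in> set (labels (ts ! i)) \<or> (\<exists>t\<in>set ts. in_child t y i x)"
  by (auto simp: in_child_def)

lemma in_child_labels:
  assumes "in_child T y i x"
  shows "y \<in> set (labels T)" "x \<in> set (labels T)"
proof -
  obtain ts where ts: "Node y ts \<in> subtrees T" "i < length ts" "x \<in> set (labels (ts ! i))"
    using assms by (auto simp: in_child_def)
  show "y \<in> set (labels T)" using ts(1) by (rule node_label)
  show "x \<in> set (labels T)" using labels_subtree[OF child_in_subtrees[OF ts(1,2)]] ts(3) by blast
qed

lemma in_child_decreasing:
  assumes "decreasing s T" "in_child T y i x"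
  shows "x < y" "i \<le> part s y"
  using assms unfolding decreasing_def in_child_def by fastforce+

lemma in_child_unique:
  assumes d: "distinct (labels T)" and "in_child T y i x" "in_child T y j x"
  shows "i = j"
proof -
  obtain ts where ts: "Node y ts \<in> subtrees T" "i < length ts" "x \<in> set (labels (ts ! i))"
      "j < length ts" "x \<in> set (labels (ts ! j))"
    using assms node_unique[OF d] by (auto simp: in_child_def)
  have "distinct (labels (Node y ts))" using distinct_subtree ts(1) d by blast
  then show ?thesis using disjoint_children[OF _ ts(2,4,3,5)] by simp
qed

lemma in_child_trans:
  assumes d: "distinct (labels T)" and "in_child T z j y" "in_child T y i x"
  shows "in_child T z j x"
proof -
  obtain ts where ts: "Node z ts \<in> subtrees T" "j < length ts" "y \<in> set (labels (ts ! j))"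
    using assms by (auto simp: in_child_def)
  obtain us where us: "Node y us \<in> subtrees T" "i < length us" "x \<in> set (labels (us ! i))"
    using assms by (auto simp: in_child_def)
  obtain vs where vs: "Node y vs \<in> subtrees (ts ! j)" using label_in_subtrees ts(3) by blast
  have "vs = us"
    using node_unique[OF d] vs us(1) subtrees_trans[OF child_in_subtrees[OF ts(1,2)]] by blast
  then have "in_child (ts ! j) y i x" using vs us by (auto simp: in_child_def)
  then have "x \<in> set (labels (ts ! j))" by (rule in_child_labels(2))
  then show ?thesis using ts unfolding in_child_def by blast
qed

text \<open>The ancestors of \<open>x\<close> form a chain along which labels grow towards the root.
  Of two ancestors, the one with smaller label therefore lies below the other, on the same side as
  \<open>x\<close>.\<close>

lemma in_child_comparable:
  "\<lbrakk>decreasing s T; in_child T z j x; in_child T y i x; y < z\<rbrakk> \<Longrightarrow> in_child T z j y"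
proof (induction T)
  case (Node r ts)
  note D = Node.prems(1)[unfolded decreasing_Node_iff]
  have lt: "w < r" if "t \<in> set ts" "in_child t w k v" for t w k v
    using that D in_child_labels(1) by blast
  have "y \<noteq> r"
    using Node.prems(2,4) lt by (metis in_child_Node order.asym order.irrefl)
  then obtain t where t: "t \<in> set ts" "in_child t y i x"
    using Node.prems(3) by (auto simp: in_child_Node)
  have same: "t' = t" if "t' \<in> set ts" "x \<in> set (labels t')" for t'
    using that t in_child_labels(2)[OF t(2)] disjoint_children[of ts _ _ x] D
    by (auto simp: in_set_conv_nth)
  show ?case
  proof (cases "z = r")
    case True
    have "\<not> (\<exists>t\<in>set ts. in_child t z j x)" using True lt by auto
    then have "j < length ts" "x \<in> set (labels (ts ! j))"
      using Node.prems(2) by (auto simp: in_child_Node)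
    then show ?thesis using True same[of "ts ! j"] in_child_labels(1)[OF t(2)]
      by (auto simp: in_child_Node)
  next
    case False
    then obtain t' where t': "t' \<in> set ts" "in_child t' z j x"
      using Node.prems(2) by (auto simp: in_child_Node)
    then have "t' = t" using same in_child_labels(2) by blast
    then have "in_child t z j y" using Node.IH[OF t(1)] t t' D Node.prems(4) by blast
    then show ?thesis using t by (auto simp: in_child_Node)
  qed
qed simp

lemma in_child_root:
  assumes "x \<in> set (labels (Node r ts))" "x \<noteq> r"
  shows "\<exists>i. in_child (Node r ts) r i x"
  using assms by (fastforce simp: in_child_Node in_set_conv_nth)

lemma subtree_root:
  assumes "decreasing s T" "in_child T c i a"
  obtains ts r us where "Node c ts \<in> subtrees T" "i < length ts" "ts ! i = Node r us"
    "in_child T c i r" "\<And>x. in_child T c i x \<Longrightarrow> x = r \<or> descendant T r x"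
proof -
  obtain ts where ts: "Node c ts \<in> subtrees T" "i < length ts" "a \<in> set (labels (ts ! i))"
    using assms by (auto simp: in_child_def)
  then obtain r us where r: "ts ! i = Node r us" by (cases "ts ! i") auto
  have sub: "subtrees (ts ! i) \<subseteq> subtrees T"
    using subtrees_trans[OF child_in_subtrees[OF ts(1,2)]] .
  have "x = r \<or> descendant T r x" if "in_child T c i x" for x
  proof -
    have "x \<in> set (labels (Node r us))"
      using that node_unique[of T c] assms(1) ts(1) r
      by (fastforce simp: in_child_def decreasing_def)
    then have "x = r \<or> (\<exists>k. in_child (Node r us) r k x)" using in_child_root by blast
    then show ?thesis using sub r unfolding descendant_def in_child_def by auto
  qed
  moreover have "in_child T c i r" using ts r by (auto simp: in_child_def)
  ultimately show ?thesis using that ts r by blast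
qed

text \<open>Labels decrease downwards, so the common ancestor with least label is the closest one.
  It separates \<open>x\<close> from \<open>y\<close>, and \<open>mono\<close> decides which of the
  two is on the left.\<close>

lemma incomparable_ancestor:
  assumes dec: "decreasing s T" and lab: "x \<in> set (labels T)" "y \<in> set (labels T)"
    and "x < y" and nd: "\<not> descendant T y x"
    and mono: "\<forall>z i j. in_child T z j x \<longrightarrow> in_child T z i y \<longrightarrow> j \<le> i"
  obtains z i j where "closest_common_ancestor T x y z" "in_child T z j x" "in_child T z i y" "j < i"
proof -
  let ?P = "\<lambda>z. descendant T z x \<and> descendant T z y"
  obtain r ts where T: "T = Node r ts" using lab by (cases T) auto
  \<comment> \<open>Neither \<open>x\<close> nor \<open>y\<close> is the root, hence the root is a
    common ancestor.\<close>
  have "y \<noteq> r" using in_child_root[of x r ts] lab T \<open>x < y\<close> nd unfolding descendant_def by auto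
  moreover have "x \<noteq> r"
    using in_child_root[of y r ts] lab T \<open>x < y\<close> in_child_decreasing(1)[OF dec]
    by (metis order.asym order.irrefl)
  ultimately have "?P r" using in_child_root lab T unfolding descendant_def by blast
  then obtain z where z: "?P z" and zmin: "\<And>w. ?P w \<Longrightarrow> z \<le> w"
    using exists_least_iff[of ?P] by (meson not_le)
  obtain i j where ij: "in_child T z j x" "in_child T z i y"
    using z unfolding descendant_def by blast
  have "closest_common_ancestor T x y z"
    unfolding closest_common_ancestor_def
    using z zmin in_child_decreasing(1)[OF dec] unfolding descendant_def by (meson not_le)
  \<comment> \<open>If both lay in one child subtree, its root would differ from \<open>x\<close>
    and \<open>y\<close>, as neither is below the other, and would be a common ancestor smaller than
    \<open>z\<close>.\<close>
  moreover have "i \<noteq> j"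
  proof
    assume "i = j"
    obtain r where r: "in_child T z i r" "\<And>x. in_child T z i x \<Longrightarrow> x = r \<or> descendant T r x"
      using subtree_root[OF dec ij(2)] by metis
    have "x \<noteq> r"
      using r(2)[OF ij(2)] \<open>x < y\<close> in_child_decreasing(1)[OF dec]
      unfolding descendant_def by (metis order.asym order.irrefl)
    moreover have "y \<noteq> r" using r(2)[of x] ij(1) \<open>i = j\<close> nd \<open>x < y\<close> by auto
    ultimately have "?P r" using r(2) ij \<open>i = j\<close> by blast
    then show False using zmin[of r] in_child_decreasing(1)[OF dec r(1)] by simp
  qed
  ultimately show ?thesis using that[of z j i] mono ij by (metis le_neq_implies_less)
qed

section \<open>Multiplicities read off the tree, and uniqueness of the tree\<close>

lemma inv_card_in_child:
  assumes "decreasing s T" "in_child T y i x"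
  shows "inv_card s T y x = i"
  using assms in_child_unique[of T y _ x]
  unfolding inv_card_def descendant_def decreasing_def by (auto intro!: the_equality)

text \<open>The hypothesis \<open>mono\<close> excludes the case that \<open>x\<close> is right of
  \<open>y\<close>, the only one in which incomparable nodes have value
  \<open>part s y\<close>.\<close>

lemma inv_card_incomparable:
  assumes dec: "decreasing s T" and lab: "x \<in> set (labels T)" "y \<in> set (labels T)"
    and "x < y" and nd: "\<not> descendant T y x"
    and mono: "\<forall>z i j. in_child T z j x \<longrightarrow> in_child T z i y \<longrightarrow> j \<le> i"
  shows "inv_card s T y x = 0"
proof -
  have "left_of T x y"
    using incomparable_ancestor[OF assms] unfolding left_of_def by blast
  then show ?thesis using nd by (simp add: inv_card_def)
qed

text \<open>The root is the largest label, and \<open>in_child\<close> at the root gives the label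
  set of each child, so induction applies to the children. The label sets are compared too because
  \<open>in_child\<close> is empty both on \<open>Leaf\<close> and on a node all of whose children
  are leaves.\<close>

lemma tree_eqI:
  "\<lbrakk>decreasing s T; decreasing s T'; set (labels T) = set (labels T');
    \<And>y i x. in_child T y i x \<longleftrightarrow> in_child T' y i x\<rbrakk> \<Longrightarrow> T = T'"
proof (induction T arbitrary: T')
  case Leaf
  then show ?case by (cases T') auto
next
  case (Node r ts)
  then obtain r' ts' where T': "T' = Node r' ts'" by (cases T') auto
  note D = Node.prems(1)[unfolded decreasing_Node_iff]
  note D' = Node.prems(2)[unfolded decreasing_Node_iff T']
  note L = Node.prems(3)[unfolded T'] and C = Node.prems(4)[unfolded T']
  have "x \<le> r" if "x \<in> set (labels (Node r ts))" for x
    using that D by (auto intro: less_imp_le)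
  moreover have "x \<le> r'" if "x \<in> set (labels (Node r' ts'))" for x
    using that D' by (auto intro: less_imp_le)
  ultimately have r: "r' = r" using L by (metis antisym labels.simps(2) list.set_intros(1))
  have len: "length ts = length ts'" using D D' r by simp
  have root: "in_child (Node q us) q i x \<longleftrightarrow> i < length us \<and> x \<in> set (labels (us ! i))"
    if "decreasing s (Node q us)" for q us i x
    using that in_child_labels(1) unfolding decreasing_Node_iff in_child_Node by blast
  have labels_child: "set (labels (us ! i)) = {x. in_child (Node q us) q i x}"
    if "decreasing s (Node q us)" "i < length us" for q us i
    using root[OF that(1), of i] that(2) by blast
  \<comment> \<open>The relation inside the \<open>i\<close>-th child is the one of the whole tree,
    restricted to upper nodes \<open>y\<close> in that child.\<close>
  have child: "in_child (us ! i) y j x \<longleftrightarrow> in_child (Node q us) y j x \<and> in_child (Node q us) q i y"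
    if us: "decreasing s (Node q us)" "i < length us" for q us i y j x
  proof
    assume "in_child (us ! i) y j x"
    then show "in_child (Node q us) y j x \<and> in_child (Node q us) q i y"
      using us in_child_labels(1) nth_mem unfolding root[OF us(1)] in_child_Node by blast
  next
    assume *: "in_child (Node q us) y j x \<and> in_child (Node q us) q i y"
    then have y: "y \<in> set (labels (us ! i))" "y \<noteq> q"
      using root[OF us(1)] in_child_decreasing(1)[OF us(1)] by blast+
    then obtain k where k: "k < length us" "in_child (us ! k) y j x"
      using * by (auto simp: in_child_Node in_set_conv_nth)
    then have "k = i"
      using y us disjoint_children[of us k i y] in_child_labels(1)[OF k(2)]
      by (auto simp: decreasing_Node_iff)
    then show "in_child (us ! i) y j x" using k by simp
  qed
  have "ts ! i = ts' ! i" if i: "i < length ts" for i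
  proof (rule Node.IH)
    show "ts ! i \<in> set ts" "decreasing s (ts ! i)" "decreasing s (ts' ! i)"
      using i D D' len by auto
    show "set (labels (ts ! i)) = set (labels (ts' ! i))"
      using labels_child[OF Node.prems(1) i] labels_child[OF Node.prems(2)[unfolded T'], of i] C r i len
      by simp
    show "in_child (ts ! i) y j x \<longleftrightarrow> in_child (ts' ! i) y j x" for y j x
      using child[OF Node.prems(1)] child[OF Node.prems(2)[unfolded T']] C r i len by simp
  qed
  then show ?case using len r T' by (simp add: nth_equalityI)
qed

section \<open>Multiplicity functions of s-Tamari trees\<close>

text \<open>The first clause sets the value to 0 outside the range of admissible pairs, so that
  functions can be compared at all arguments. The last clause is a form of transitivity: it makes
  values grow along descending paths.\<close>

definition tamari_mult :: "nat list \<Rightarrow> (nat \<Rightarrow> nat \<Rightarrow> nat) \<Rightarrow> bool" where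
  "tamari_mult s f \<longleftrightarrow>
     (\<forall>y x. 0 < f y x \<longrightarrow> 1 \<le> x \<and> x < y \<and> y \<le> length s) \<and>
     (\<forall>y x. f y x \<le> part s y) \<and>
     (\<forall>a b c. 1 \<le> a \<and> a < b \<and> b < c \<longrightarrow> f c a \<le> f c b) \<and>
     (\<forall>x y z. 0 < f y x \<longrightarrow> f z y \<le> f z x)"

lemma tamari_multD:
  assumes "tamari_mult s f"
  shows "0 < f y x \<Longrightarrow> 1 \<le> x \<and> x < y \<and> y \<le> length s"
    and "f y x \<le> part s y"
    and "1 \<le> a \<Longrightarrow> a < b \<Longrightarrow> b < c \<Longrightarrow> f c a \<le> f c b"
    and "0 < f y x \<Longrightarrow> f z y \<le> f z x"
  using assms unfolding tamari_mult_def by blast+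

abbreviation mult :: "nat list \<Rightarrow> tree \<Rightarrow> nat \<Rightarrow> nat \<Rightarrow> nat" where
  "mult s T y x \<equiv> count (tree_inv s T) (y, x)"

context
  fixes s T
  assumes tam: "s_tamari_tree s T"
begin

lemma tamari_decreasing: "decreasing s T" and tamari_labels: "set (labels T) = {1..length s}"
  using tam unfolding s_tamari_tree_def s_decreasing_tree_iff by auto

lemma mult_in_child:
  assumes "in_child T y i x"
  shows "mult s T y x = i"
  using inv_card_in_child[OF tamari_decreasing assms] in_child_labels[OF assms]
    in_child_decreasing(1)[OF tamari_decreasing assms] tamari_labels
  by (auto simp: count_tree_inv)

lemma mult_mono: "1 \<le> a \<Longrightarrow> a < b \<Longrightarrow> b < c \<Longrightarrow> mult s T c a \<le> mult s T c b"
  using tam unfolding s_tamari_tree_def count_tree_inv by auto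

lemma tamari_in_child_mono:
  assumes "x < y"
  shows "\<forall>z i j. in_child T z j x \<longrightarrow> in_child T z i y \<longrightarrow> j \<le> i"
proof (intro allI impI)
  fix z i j
  assume ij: "in_child T z j x" "in_child T z i y"
  have "1 \<le> x" using in_child_labels(2)[OF ij(1)] tamari_labels by simp
  then show "j \<le> i"
    using mult_mono[of x y z] mult_in_child assms ij in_child_decreasing(1)[OF tamari_decreasing]
    by metis
qed

lemma mult_incomparable:
  assumes "\<not> descendant T y x"
  shows "mult s T y x = 0"
  using inv_card_incomparable[OF tamari_decreasing _ _ _ assms tamari_in_child_mono]
    tamari_labels by (auto simp: count_tree_inv)

text \<open>Either \<open>y\<close>, and with it \<open>x\<close>, lies in one child subtree of
  \<open>z\<close>, or neither is below \<open>z\<close> because the ancestors of \<open>x\<close>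
  form a chain; then both values are 0.\<close>

lemma mult_descendant:
  assumes "descendant T y x" "y < z"
  shows "mult s T z x = mult s T z y"
proof (cases "descendant T z y")
  case True
  then show ?thesis
    using assms(1) in_child_trans mult_in_child tamari_decreasing
    unfolding descendant_def decreasing_def by metis
next
  case False
  then have "\<not> descendant T z x"
    using assms in_child_comparable[OF tamari_decreasing] unfolding descendant_def by blast
  then show ?thesis using False by (simp add: mult_incomparable)
qed

lemma tamari_mult_mult: "tamari_mult s (mult s T)"
proof -
  have "mult s T y x \<le> part s y" for y x
    using mult_incomparable[of y x] mult_in_child in_child_decreasing(2)[OF tamari_decreasing]
    unfolding descendant_def by (metis le0)
  moreover have "mult s T z y \<le> mult s T z x" if "0 < mult s T y x" for x y z
  proof (cases "y < z")
    case True
    have "descendant T y x" using that mult_incomparable by (metis less_irrefl)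
    then show ?thesis using mult_descendant True by simp
  qed (simp add: count_tree_inv)
  moreover have "1 \<le> x \<and> x < y \<and> y \<le> length s" if "0 < mult s T y x" for y x
    using that by (auto simp: count_tree_inv split: if_splits)
  ultimately show ?thesis using mult_mono unfolding tamari_mult_def by blast
qed

text \<open>The value 0 at \<open>(y, x)\<close> does not tell a leftmost descendant from an
  incomparable node. The larger labels do: incomparable nodes get different values at their closest
  common ancestor.\<close>

lemma descendant_iff:
  assumes "1 \<le> x" "x < y" "y \<le> length s"
  shows "descendant T y x \<longleftrightarrow> (\<forall>z>y. mult s T z x = mult s T z y)"
proof
  show "\<forall>z>y. mult s T z x = mult s T z y" if "descendant T y x"
    using that mult_descendant by blast
next
  assume *: "\<forall>z>y. mult s T z x = mult s T z y"
  show "descendant T y x"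
  proof (rule ccontr)
    assume nd: "\<not> descendant T y x"
    obtain z i j where "in_child T z j x" "in_child T z i y" "j < i"
      using incomparable_ancestor[OF tamari_decreasing _ _ \<open>x < y\<close> nd tamari_in_child_mono]
        assms tamari_labels by (metis atLeastAtMost_iff le_trans less_imp_le)
    then show False
      using * mult_in_child in_child_decreasing(1)[OF tamari_decreasing] by (metis less_irrefl)
  qed
qed

lemma in_child_iff:
  "in_child T y i x \<longleftrightarrow>
     1 \<le> x \<and> x < y \<and> y \<le> length s \<and> mult s T y x = i \<and> (\<forall>z>y. mult s T z x = mult s T z y)"
  (is "?L \<longleftrightarrow> ?R")
proof
  assume L: ?L
  have "1 \<le> x \<and> x < y \<and> y \<le> length s"
    using in_child_labels[OF L] tamari_labels in_child_decreasing(1)[OF tamari_decreasing L] by simp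
  then show ?R using L mult_in_child descendant_iff unfolding descendant_def by blast
next
  assume ?R
  then show ?L using mult_in_child descendant_iff unfolding descendant_def by metis
qed

text \<open>A node is the root of its child subtree iff it has the largest label there. By
  monotonicity this means that every label strictly between \<open>a\<close> and \<open>c\<close>
  has a strictly larger value at \<open>c\<close>.\<close>

lemma tamari_ascent_iff:
  "tamari_ascent s T a c \<longleftrightarrow>
     1 \<le> a \<and> a < c \<and> c \<le> length s \<and> mult s T c a < part s c \<and>
     (\<forall>z>c. mult s T z a = mult s T z c) \<and>
     (\<forall>b. a < b \<and> b < c \<longrightarrow> mult s T c a < mult s T c b)" (is "?L \<longleftrightarrow> ?R")
proof
  assume ?L
  then obtain ts i us where ts: "Node c ts \<in> subtrees T" "i < part s c" "ts ! i = Node a us"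
    unfolding tamari_ascent_def by blast
  have len: "i < length ts" using tamari_decreasing ts(1,2) unfolding decreasing_def by simp
  have a: "in_child T c i a" using ts len by (auto simp: in_child_def)
  note A = a[unfolded in_child_iff]
  have "mult s T c a < mult s T c b" if b: "a < b" "b < c" for b
  proof (rule ccontr)
    assume "\<not> mult s T c a < mult s T c b"
    then have eq: "mult s T c b = i" using mult_mono[of a b c] A b by simp
    \<comment> \<open>The value at \<open>b\<close> is squeezed between those at \<open>a\<close>
      and \<open>c\<close>, which agree. So \<open>b\<close> is a descendant of \<open>c\<close> in
      the same subtree as \<open>a\<close>.\<close>
    have "mult s T z b = mult s T z c" if "c < z" for z
      using that mult_mono[of a b z] mult_mono[of b c z] A b by simp
    then have "in_child T c i b" using eq A b in_child_iff by simp
    then have "b \<in> set (labels (Node a us))"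
      using ts node_unique[of T c] tamari_decreasing by (fastforce simp: in_child_def decreasing_def)
    moreover have "decreasing s (Node a us)"
      using decreasing_subtree[OF child_in_subtrees[OF ts(1) len] tamari_decreasing] ts(3) by simp
    ultimately show False using b(1) by (auto simp: decreasing_Node_iff dest: order.asym)
  qed
  then show ?R using A ts(2) by simp
next
  assume R: ?R
  then have "in_child T c (mult s T c a) a" by (simp add: in_child_iff)
  then obtain ts r us where r: "Node c ts \<in> subtrees T" "ts ! mult s T c a = Node r us"
    "in_child T c (mult s T c a) r" "a = r \<or> descendant T r a"
    using subtree_root[OF tamari_decreasing] by metis
  \<comment> \<open>The root \<open>r\<close> of the subtree containing \<open>a\<close> has the
    same value at \<open>c\<close> as \<open>a\<close>, so strictness excludes
    \<open>a < r\<close>.\<close>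
  have "\<not> a < r" using R r(3)[unfolded in_child_iff] by auto
  then have "a = r" using r(4) in_child_decreasing(1)[OF tamari_decreasing]
    unfolding descendant_def by blast
  then show ?L using R r unfolding tamari_ascent_def by blast
qed

end

section \<open>Trees with prescribed multiplicities\<close>

lemma tamari_tree_eqI:
  assumes "s_tamari_tree s T" "s_tamari_tree s T'" "tree_inv s T = tree_inv s T'"
  shows "T = T'"
  using assms tree_eqI[of s T T'] tamari_decreasing tamari_labels
  by (simp add: in_child_iff[OF assms(1)] in_child_iff[OF assms(2)])

lemma s_weak_le_iff: "s_weak_le s R T \<longleftrightarrow> (\<forall>y x. mult s R y x \<le> mult s T y x)"
  unfolding s_weak_le_def count_tree_inv by auto

text \<open>Arbitrary label sets \<open>S\<close> make the recursion possible: the root is the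
  maximum \<open>c\<close> of \<open>S\<close>, and every other label \<open>a\<close> goes to the
  child with index \<open>f c a\<close>.\<close>

lemma ex_tree_of_mult:
  assumes f: "tamari_mult s f" and "S \<subseteq> {1..length s}"
  shows "\<exists>T. decreasing s T \<and> set (labels T) = S \<and>
     (\<forall>y i x. in_child T y i x \<longrightarrow> f y x = i) \<and>
     (\<forall>y\<in>S. \<forall>x\<in>S. x < y \<and> \<not> descendant T y x \<longrightarrow> f y x = 0)"
  using assms(2)
proof (induction "card S" arbitrary: S rule: less_induct)
  case less
  have fin: "finite S" using less.prems finite_subset by blast
  show ?case
  proof (cases "S = {}")
    case True
    then show ?thesis
      by (intro exI[of _ Leaf]) (auto simp: decreasing_def)
  next
    case False
    define c where "c = Max S"
    have c: "c \<in> S" "\<And>x. x \<in> S \<Longrightarrow> x \<noteq> c \<Longrightarrow> x < c"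
      using False fin by (auto simp: c_def order.not_eq_order_implies_strict)
    define S' where "S' i = {a \<in> S. a \<noteq> c \<and> f c a = i}" for i
    have "card (S' i) < card S" for i
      by (rule psubset_card_mono[OF fin]) (use c in \<open>auto simp: S'_def\<close>)
    moreover have "S' i \<subseteq> {1..length s}" for i using less.prems by (auto simp: S'_def)
    ultimately have "\<forall>i. \<exists>T. decreasing s T \<and> set (labels T) = S' i \<and>
       (\<forall>y i x. in_child T y i x \<longrightarrow> f y x = i) \<and>
       (\<forall>y\<in>S' i. \<forall>x\<in>S' i. x < y \<and> \<not> descendant T y x \<longrightarrow> f y x = 0)"
      using less.hyps by blast
    then obtain U where U: "\<And>i. decreasing s (U i)" "\<And>i. set (labels (U i)) = S' i"
      "\<And>k y i x. in_child (U k) y i x \<Longrightarrow> f y x = i"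
      "\<And>i y x. \<lbrakk>y \<in> S' i; x \<in> S' i; x < y; \<not> descendant (U i) y x\<rbrakk> \<Longrightarrow> f y x = 0"
      by metis
    define n where "n = Suc (part s c)"
    define ts where "ts = map U [0..<n]"
    have ts: "length ts = n" "\<And>i. i < n \<Longrightarrow> ts ! i = U i" by (auto simp: ts_def)
    have lt: "f c x < n" for x using tamari_multD(2)[OF f] by (simp add: n_def less_Suc_eq_le)
    have "distinct (concat (map (labels \<circ> U) [0..<k]))" for k
      by (induction k) (use U(1,2) in \<open>auto simp: S'_def decreasing_def\<close>)
    then have "distinct (concat (map labels ts))" by (simp add: ts_def)
    moreover have cts: "set (concat (map labels ts)) = S - {c}"
      using U(2) lt by (auto simp: ts_def S'_def)
    ultimately have "distinct (labels (Node c ts))" by simp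
    moreover have "x < c" if "x \<in> set (labels (U i))" for i x
      using that U(2) c(2) by (auto simp: S'_def)
    ultimately have dec: "decreasing s (Node c ts)"
      unfolding decreasing_Node_iff using U(1) ts(1) by (auto simp: n_def ts_def)
    have "set (labels (Node c ts)) = S" using cts c by auto
    moreover have "f y x = i" if "in_child (Node c ts) y i x" for y i x
      using that U(2,3) ts by (auto simp: in_child_Node S'_def ts_def)
    moreover have "f y x = 0" if "y \<in> S" "x \<in> S" "x < y" "\<not> descendant (Node c ts) y x" for y x
    proof -
      have inS: "w \<in> S' (f c w)" if "w \<in> S" "w \<noteq> c" for w using that by (simp add: S'_def)
      have "x \<noteq> c" using that c(2)[of y] by auto
      have "y \<noteq> c"
        using that in_child_root[of x c ts] \<open>x \<noteq> c\<close> calculation(1) unfolding descendant_def by blast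
      show ?thesis
      \<comment> \<open>Within one child the induction hypothesis applies. In different children
        monotonicity gives \<open>f c x < f c y\<close>, which the transitivity clause forbids when
        \<open>f y x\<close> is positive.\<close>
      proof (cases "f c x = f c y")
        case True
        have "\<not> descendant (U (f c y)) y x"
          using that(4) lt[of y] unfolding descendant_def by (auto simp: in_child_Node ts_def)
        then show ?thesis using U(4)[of y "f c y" x] that inS \<open>x \<noteq> c\<close> \<open>y \<noteq> c\<close> True by metis
      next
        case False
        have "f c x \<le> f c y"
          using tamari_multD(3)[OF f, of x y c] that less.prems c \<open>y \<noteq> c\<close> by auto
        then show ?thesis using False tamari_multD(4)[OF f, of y x c] by force
      qed
    qed
    ultimately show ?thesis using dec by blast
  qed
qed

lemma ex_tamari_tree:
  assumes f: "tamari_mult s f"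
  obtains T where "s_tamari_tree s T" "\<And>y x. mult s T y x = f y x"
proof -
  obtain T where T: "decreasing s T" "set (labels T) = {1..length s}"
    "\<And>y i x. in_child T y i x \<Longrightarrow> f y x = i"
    "\<And>y x. \<lbrakk>y \<in> {1..length s}; x \<in> {1..length s}; x < y; \<not> descendant T y x\<rbrakk> \<Longrightarrow> f y x = 0"
    using ex_tree_of_mult[OF f order.refl] by blast
  have eq: "inv_card s T y x = f y x" if xy: "1 \<le> x" "x < y" "y \<le> length s" for y x
  proof (cases "descendant T y x")
    case True
    then show ?thesis
      using inv_card_in_child[OF T(1)] T(3) unfolding descendant_def by metis
  next
    case False
    have "\<forall>z i j. in_child T z j x \<longrightarrow> in_child T z i y \<longrightarrow> j \<le> i"
      using tamari_multD(3)[OF f, of x y] xy T(3) in_child_decreasing(1)[OF T(1)] by metis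
    then have "inv_card s T y x = 0"
      using inv_card_incomparable[OF T(1) _ _ _ False] T(2) xy by auto
    then show ?thesis using T(4) False xy by simp
  qed
  have "s_tamari_tree s T"
    unfolding s_tamari_tree_def s_decreasing_tree_iff
    using T(1,2) eq tamari_multD(3)[OF f] by auto
  moreover have "mult s T y x = f y x" for y x
    using eq tamari_multD(1)[OF f, of y x] by (auto simp: count_tree_inv)
  ultimately show ?thesis using that by blast
qed

section \<open>Rotations\<close>

text \<open>For \<open>x\<close> with \<open>f a x > 0\<close> one has \<open>f c x = f c a\<close>, so the first case is also \<open>Suc (f c x)\<close>.\<close>

definition rotate :: "(nat \<Rightarrow> nat \<Rightarrow> nat) \<Rightarrow> nat \<Rightarrow> nat \<Rightarrow> nat \<Rightarrow> nat \<Rightarrow> nat" where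
  "rotate f c a y x = (if y = c \<and> (x = a \<or> 0 < f a x) then Suc (f c a) else f y x)"

text \<open>Along a path the transitivity clause makes the values of \<open>f\<close> at the fixed
  first node \<open>bs ! 0\<close> weakly increase. Hence such an \<open>f\<close> bounds the
  closure of every multiset it bounds.\<close>

lemma tc_path_le:
  assumes f: "tamari_mult s f" and le: "\<And>y x. count I (y, x) \<le> f y x" and p: "tc_path I c a bs"
  shows "count I (bs ! 0, bs ! 1) \<le> f c a"
proof -
  have len: "2 \<le> length bs" and ne: "bs \<noteq> []" using p by (auto simp: tc_path_def)
  have pos: "0 < f (bs ! i) (bs ! Suc i)" if "Suc i < length bs" for i
    using p that le[of "bs ! i" "bs ! Suc i"] unfolding tc_path_def
    by (metis Suc_eq_plus1 less_le_trans)
  have "count I (bs ! 0, bs ! 1) \<le> f (bs ! 0) (bs ! Suc j)" if "Suc j < length bs" for j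
    using that
  proof (induction j)
    case (Suc j)
    then show ?case
      using tamari_multD(4)[OF f pos[of "Suc j"], of "bs ! 0"] by simp
  qed (simp add: le)
  \<comment> \<open>For this index \<open>bs ! Suc j\<close> is the last entry of the path.\<close>
  from this[of "length bs - 2"] show ?thesis
    using p len ne by (simp add: tc_path_def hd_conv_nth last_conv_nth Suc_diff_Suc numeral_2_eq_2)
qed

section \<open>Rotation at a Tamari-ascent\<close>

context
  fixes s f a c
  assumes f: "tamari_mult s f"
    and ac: "1 \<le> a" "a < c" "c \<le> length s" "f c a < part s c"
    and above: "\<And>z. c < z \<Longrightarrow> f z a = f z c"
    and between: "\<And>b. a < b \<Longrightarrow> b < c \<Longrightarrow> f c a < f c b"
begin

lemma mult_below_ascent:
  assumes "0 < f a x"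
  shows "1 \<le> x" "x < a" "f c x = f c a"
proof -
  show x: "1 \<le> x" "x < a" using tamari_multD(1)[OF f assms] by auto
  show "f c x = f c a" using tamari_multD(4)[OF f assms] tamari_multD(3)[OF f x ac(2)] by (metis antisym)
qed

lemma rotate_ge: "f y x \<le> rotate f c a y x"
  using mult_below_ascent by (auto simp: rotate_def)

lemma tamari_mult_rotate: "tamari_mult s (rotate f c a)"
proof -
  have "1 \<le> x \<and> x < y \<and> y \<le> length s" if "0 < rotate f c a y x" for y x
    using that tamari_multD(1)[OF f, of y x] ac mult_below_ascent[of x]
    by (auto simp: rotate_def split: if_splits)
  moreover have "rotate f c a y x \<le> part s y" for y x
    using tamari_multD(2)[OF f] ac by (auto simp: rotate_def)
  moreover have "rotate f c a z x \<le> rotate f c a z y" if xy: "1 \<le> x" "x < y" "y < z" for x y z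
  \<comment> \<open>The critical case increments only the smaller argument \<open>x\<close>. Then
    \<open>a < y\<close>, and the strict inequality \<open>between\<close> leaves room for the
    increment.\<close>
  proof (cases "z = c \<and> (x = a \<or> 0 < f a x) \<and> \<not> (y = a \<or> 0 < f a y)")
    case True
    then have "a < y"
      using xy tamari_multD(3)[OF f, of x y a] by force
    then show ?thesis using True between[of y] xy by (auto simp: rotate_def)
  next
    case False
    then show ?thesis
      using tamari_multD(3)[OF f xy] rotate_ge[of c y] by (auto simp: rotate_def split: if_splits)
  qed
  moreover have "rotate f c a z y \<le> rotate f c a z x" if pos: "0 < rotate f c a y x" for x y z
  proof (cases "z = c")
    case True
    show ?thesis
    \<comment> \<open>If the pair \<open>(c, y)\<close> is incremented, transitivity of
      \<open>f\<close> gives \<open>0 < f a x\<close>, so \<open>(c, x)\<close> is incremented as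
      well.\<close>
    proof (cases "y = a \<or> 0 < f a y")
      case A: True
      then have "y < c" using ac mult_below_ascent(2)[of y] by auto
      then have "0 < f y x" using pos by (simp add: rotate_def)
      then have "0 < f a x" using A tamari_multD(4)[OF f, of y x a] by auto
      then show ?thesis using A True by (auto simp add: rotate_def)
    next
      case A: False
      show ?thesis
      proof (cases "y = c")
        case True
        have "f c c = 0" using tamari_multD(1)[OF f, of c c] by (metis gr0I less_irrefl)
        then show ?thesis using \<open>y = c\<close> \<open>z = c\<close> A
          by (simp add: rotate_def)
      next
        case False
        then have "f c y \<le> f c x" using pos tamari_multD(4)[OF f] by (simp add: rotate_def)
        moreover have "rotate f c a c y = f c y" using A by (simp add: rotate_def)
        ultimately show ?thesis using True rotate_ge[of c x] by simp
      qed
    qed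
  next
    case False
    show ?thesis
    \<comment> \<open>Positivity can be new only at incremented pairs \<open>(c, x)\<close>. There
      \<open>above\<close> replaces \<open>f z c\<close> by \<open>f z a\<close>, which is at most
      \<open>f z x\<close>; for \<open>z \<le> c\<close> the value \<open>f z c\<close> is
      0.\<close>
    proof (cases "y = c \<and> (x = a \<or> 0 < f a x)")
      case True
      have "f z c \<le> f z x"
      proof (cases "c < z")
        case zc: True
        then show ?thesis using True above[OF zc] tamari_multD(4)[OF f, of a x z] by auto
      next
        case False
        then show ?thesis using tamari_multD(1)[OF f, of z c] by force
      qed
      then show ?thesis using True False by (simp add: rotate_def)
    next
      case F: False
      then have "0 < f y x" using pos by (auto simp: rotate_def split: if_splits)
      then show ?thesis using tamari_multD(4)[OF f] False by (simp add: rotate_def)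
    qed
  qed
  ultimately show ?thesis unfolding tamari_mult_def by blast
qed

text \<open>The upper bound is \<open>tc_path_le\<close> applied to \<open>rotate f c a\<close>,
  which dominates the enlarged multiset. Explicit paths attain it.\<close>

lemma count_tc_rotate:
  assumes I: "\<And>y x. count I (y, x) = f y x"
  shows "count (tc (add_mset (c, a) I)) (y, x) = rotate f c a y x"
proof -
  let ?J = "add_mset (c, a) I"
  have J: "count ?J (y, x) = (if y = c \<and> x = a then Suc (f c a) else f y x)" for y x
    by (simp add: I)
  let ?V = "{count ?J (bs ! 0, bs ! 1) | bs. tc_path ?J y x bs}"
  have "count ?J (y, x) \<le> rotate f c a y x" for y x
    unfolding J using rotate_ge[of y x] by (auto simp: rotate_def)
  then have le: "v \<le> rotate f c a y x" if "v \<in> ?V" for v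
    using that tc_path_le[OF tamari_mult_rotate] by blast
  have mem: "rotate f c a y x \<in> insert 0 ?V"
  proof (cases "y = c \<and> x \<noteq> a \<and> 0 < f a x")
    case True
    \<comment> \<open>The first edge of this path carries the incremented multiplicity
      \<open>Suc (f c a)\<close>; all other positive values come from paths with a single
      edge.\<close>
    then have "tc_path ?J y x [c, a, x]"
      using ac mult_below_ascent[of x] I
      by (auto simp: tc_path_def less_Suc_eq numeral_2_eq_2)
    then show ?thesis using True I by (force simp: rotate_def)
  next
    case F: False
    then have eq: "rotate f c a y x = count ?J (y, x)" unfolding J by (auto simp: rotate_def)
    show ?thesis
    proof (cases "0 < rotate f c a y x")
      case True
      then have "tc_path ?J y x [y, x]"
        using tamari_multD(1)[OF tamari_mult_rotate True] eq by (auto simp: tc_path_def)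
      then show ?thesis using eq by force
    qed simp
  qed
  show ?thesis
    unfolding count_tc
  proof (rule Max_eqI)
    show "finite (insert 0 ?V)" by (simp only: finite_insert finite_tc_values)
    show "v \<le> rotate f c a y x" if "v \<in> insert 0 ?V" for v using that le by blast
  qed (rule mem)
qed

text \<open>If \<open>f a x\<close> is positive, so is \<open>h a x\<close>, and transitivity of
  \<open>h\<close> carries the increment from \<open>(c, a)\<close> to
  \<open>(c, x)\<close>.\<close>

lemma rotate_le_iff:
  assumes h: "tamari_mult s h" and "\<And>y x. f y x \<le> h y x"
  shows "(\<forall>y x. rotate f c a y x \<le> h y x) \<longleftrightarrow> f c a < h c a"
proof
  assume "\<forall>y x. rotate f c a y x \<le> h y x"
  then have "rotate f c a c a \<le> h c a" by blast
  then show "f c a < h c a" by (simp add: rotate_def)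
next
  assume lt: "f c a < h c a"
  have "Suc (f c a) \<le> h c x" if "0 < f a x" for x
    using that tamari_multD(4)[OF h, of a x c] assms(2)[of a x] lt by simp
  then show "\<forall>y x. rotate f c a y x \<le> h y x"
    using assms(2) lt by (auto simp: rotate_def)
qed

lemma no_mult_strictly_between:
  assumes h: "tamari_mult s h" and fh: "\<And>y x. f y x \<le> h y x"
    and hg: "\<And>y x. h y x \<le> rotate f c a y x"
  shows "(\<forall>y x. h y x = f y x) \<or> (\<forall>y x. h y x = rotate f c a y x)"
proof (cases "f c a < h c a")
  case True
  then show ?thesis using rotate_le_iff[OF h fh] hg by (metis antisym)
next
  case False
  \<comment> \<open>For \<open>x\<close> with \<open>f a x\<close> positive,
    \<open>h c x \<le> h c a \<le> f c a = f c x\<close> by monotonicity of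
    \<open>h\<close>.\<close>
  have "h y x \<le> f y x" for y x
  proof (cases "y = c \<and> 0 < f a x")
    case True
    then have "h c x \<le> h c a" using tamari_multD(3)[OF h, of x a c] mult_below_ascent ac by simp
    then show ?thesis using True mult_below_ascent False by simp
  next
    case F: False
    then show ?thesis using hg[of y x] False by (auto simp: rotate_def split: if_splits)
  qed
  then show ?thesis using fh by (metis antisym)
qed

end

text \<open>The pair is extremal: \<open>c\<close> is the largest first argument at which
  \<open>f\<close> and \<open>h\<close> differ, and \<open>a\<close> the largest second argument for
  this \<open>c\<close>. Beyond it \<open>f\<close> inherits the required relations from
  \<open>h\<close>.\<close>

lemma ex_ascent:
  assumes f: "tamari_mult s f" and h: "tamari_mult s h"
    and le: "\<And>y x. f y x \<le> h y x" and "f y\<^sub>0 x\<^sub>0 < h y\<^sub>0 x\<^sub>0"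
  obtains a c where "1 \<le> a" "a < c" "c \<le> length s" "f c a < part s c" "f c a < h c a"
    "\<And>z. c < z \<Longrightarrow> f z a = f z c" "\<And>b. a < b \<Longrightarrow> b < c \<Longrightarrow> f c a < f c b"
proof -
  have bd: "1 \<le> x \<and> x < y \<and> y \<le> length s" if "f y x < h y x" for y x
    using that tamari_multD(1)[OF h, of y x] by force
  define c where "c = (GREATEST y. \<exists>x. f y x < h y x)"
  have c: "\<exists>x. f c x < h c x"
    unfolding c_def by (rule GreatestI_nat[of _ y\<^sub>0 "length s"]) (use assms(4) bd in blast)+
  have cmax: "y \<le> c" if "f y x < h y x" for y x
    unfolding c_def by (rule Greatest_le_nat[of _ _ "length s"]) (use that bd in blast)+
  define a where "a = (GREATEST x. f c x < h c x)"
  have le_c: "\<And>x. f c x < h c x \<Longrightarrow> x \<le> c" using bd less_imp_le by blast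
  have a: "f c a < h c a"
    unfolding a_def using c le_c by (auto intro: GreatestI_ex_nat[of _ c])
  have amax: "x \<le> a" if "f c x < h c x" for x
    unfolding a_def by (rule Greatest_le_nat[of _ _ c]) (use that le_c in blast)+
  have rng: "1 \<le> a" "a < c" "c \<le> length s" using bd[OF a] by auto
  have "f z a = f z c" if "c < z" for z
  proof -
    have "f z x = h z x" for x using cmax[of z x] that le[of z x] by force
    \<comment> \<open>One inequality is transitivity, since \<open>h c a\<close> is positive, the
      other is monotonicity.\<close>
    moreover have "h z a = h z c"
      using tamari_multD(4)[OF h, of c a z] tamari_multD(3)[OF h rng(1,2) that] a by simp
    ultimately show ?thesis by simp
  qed
  \<comment> \<open>By maximality of \<open>a\<close>,
    \<open>f c b = h c b \<ge> h c a > f c a\<close>.\<close>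
  moreover have "f c a < f c b" if "a < b" "b < c" for b
    using amax[of b] le[of c b] tamari_multD(3)[OF h rng(1) that] a that(1) by force
  moreover have "f c a < part s c" using a tamari_multD(2)[OF h, of c a] by simp
  ultimately show ?thesis using that rng a by blast
qed

theorem theorem2p25:
  fixes s :: "nat list" and T T' :: tree
  assumes "s_tamari_tree s T" and "s_tamari_tree s T'"
  shows "s_tamari_covers s T' T \<longleftrightarrow>
    (\<exists>a c. tamari_ascent s T a c \<and> tree_inv s T' = tc (add_mset (c, a) (tree_inv s T)))"
proof
  note f = tamari_mult_mult[OF assms(1)] and h = tamari_mult_mult[OF assms(2)]
  have eqI: "R = R'" if "s_tamari_tree s R" "s_tamari_tree s R'"
    "\<And>y x. mult s R y x = mult s R' y x" for R R'
    using tamari_tree_eqI[OF that(1,2)] that(3) by (simp add: multiset_eq_iff)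
  {
    assume "s_tamari_covers s T' T"
    then have le: "\<And>y x. mult s T y x \<le> mult s T' y x" and "T \<noteq> T'"
      and cov: "\<And>R. \<lbrakk>s_tamari_tree s R; s_weak_le s T R; s_weak_le s R T'\<rbrakk> \<Longrightarrow> R = T \<or> R = T'"
      unfolding s_tamari_covers_def covers_in_def by (auto simp: s_weak_le_iff)
    obtain y x where "mult s T y x < mult s T' y x"
      using \<open>T \<noteq> T'\<close> eqI[OF assms] le by (metis order.not_eq_order_implies_strict)
    then obtain a c where ac: "1 \<le> a" "a < c" "c \<le> length s" "mult s T c a < part s c"
      "\<And>z. c < z \<Longrightarrow> mult s T z a = mult s T z c"
      "\<And>b. a < b \<Longrightarrow> b < c \<Longrightarrow> mult s T c a < mult s T c b"
      and lt: "mult s T c a < mult s T' c a"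
      using ex_ascent[OF f h le] by metis
    \<comment> \<open>The rotated tree \<open>R\<close> lies weakly between \<open>T\<close> and
      \<open>T'\<close> and differs from \<open>T\<close>, so the cover relation forces
      \<open>R = T'\<close>.\<close>
    obtain R where R: "s_tamari_tree s R" "\<And>y x. mult s R y x = rotate (mult s T) c a y x"
      using ex_tamari_tree[OF tamari_mult_rotate[OF f ac]] by metis
    have "s_weak_le s T R" using rotate_ge[OF f ac] R(2) by (simp add: s_weak_le_iff)
    moreover have "s_weak_le s R T'"
      using rotate_le_iff[OF f ac h le] lt R(2) by (simp add: s_weak_le_iff)
    moreover have "R \<noteq> T" using R(2)[of c a] by (auto simp: rotate_def)
    ultimately have "R = T'" using cov R(1) by blast
    then have "tree_inv s T' = tc (add_mset (c, a) (tree_inv s T))"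
      using R(2) count_tc_rotate[OF f ac refl] by (auto intro!: multiset_eqI)
    moreover have "tamari_ascent s T a c" unfolding tamari_ascent_iff[OF assms(1)] using ac by blast
    ultimately show "\<exists>a c. tamari_ascent s T a c \<and>
        tree_inv s T' = tc (add_mset (c, a) (tree_inv s T))" by blast
  next
    assume "\<exists>a c. tamari_ascent s T a c \<and> tree_inv s T' = tc (add_mset (c, a) (tree_inv s T))"
    then obtain a c where asc: "tamari_ascent s T a c"
      and eq: "tree_inv s T' = tc (add_mset (c, a) (tree_inv s T))" by blast
    have ac: "1 \<le> a" "a < c" "c \<le> length s" "mult s T c a < part s c"
      "\<And>z. c < z \<Longrightarrow> mult s T z a = mult s T z c"
      "\<And>b. a < b \<Longrightarrow> b < c \<Longrightarrow> mult s T c a < mult s T c b"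
      using asc unfolding tamari_ascent_iff[OF assms(1)] by blast+
    have T': "mult s T' y x = rotate (mult s T) c a y x" for y x
      unfolding eq by (rule count_tc_rotate[OF f ac refl])
    have "T \<noteq> T'" using T'[of c a] by (auto simp: rotate_def)
    moreover have "s_weak_le s T T'" using rotate_ge[OF f ac] T' by (simp add: s_weak_le_iff)
    moreover have "R = T \<or> R = T'"
      if R: "s_tamari_tree s R" "s_weak_le s T R" "s_weak_le s R T'" for R
    proof -
      have "(\<forall>y x. mult s R y x = mult s T y x) \<or> (\<forall>y x. mult s R y x = rotate (mult s T) c a y x)"
        using no_mult_strictly_between[OF f ac tamari_mult_mult[OF R(1)]] R(2,3) T'
        by (simp add: s_weak_le_iff)
      then show ?thesis
        using eqI[OF R(1) assms(1)] eqI[OF R(1) assms(2)] T' by auto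
    qed
    ultimately show "s_tamari_covers s T' T"
      unfolding s_tamari_covers_def covers_in_def using assms by auto
  }
qed

end
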